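(* Let $\lambda_1=\frac{3x+\sqrt{9x^2-8}}{2}$ and $\lambda_2=-\frac{3x-\sqrt{9x^2-8}}{2}$. For every $n\in\mathbb{N}$, the Mersenne Lucas polynomials and the Gaussian Mersenne Lucas polynomials satisfy respectively $$m_n(x)=2S_n(\lambda_1+[-\lambda_2])-3x\,S_{n-1}(\lambda_1+[-\lambda_2]),$$ $$Gm_n(x)=\left(2+\frac{3ix}{2}\right)S_n(\lambda_1+[-\lambda_2])+\left(i\left(2-\frac{9}{2}x^2\right)-3x\right)S_{n-1}(\lambda_1+[-\lambda_2]).$$
   Context: Here $i$ is the imaginary unit, and $x$ is the polynomial variable (it may be read as an arbitrary complex number, with a fixed choice of square root $\sqrt{9x^2-8}$). The Mersenne Lucas polynomials are defined by $m_0(x)=2$, $m_1(x)=3x$, $m_n(x)=3x\,m_{n-1}(x)-2m_{n-2}(x)$ for $n\ge2$. The Gaussian Mersenne Lucas polynomials are defined by $Gm_0(x)=2+\frac{3i}{2}x$, $Gm_1(x)=3x+2i$, $Gm_n(x)=3x\,Gm_{n-1}(x)-2Gm_{n-2}(x)$ for $n\ge2$. For $a,b$, the symmetric functions $S_n(a+b)$ are defined by $\sum_{n=0}^\infty S_n(a+b)z^n=\frac{1}{(1-az)(1-bz)}$ and $S_n(a+b)=0$ for $n<0$; for $a\ne b$ and $n\ge 0$ this gives $S_n(a+b)=\frac{a^{n+1}-b^{n+1}}{a-b}$. The notation $S_n(\lambda_1+[-\lambda_2])$ means $S_n(a+b)$ with $a=\lambda_1$, $b=-\lambda_2$, so that $\sum_{n=0}^\infty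 S_n(\lambda_1+[-\lambda_2])z^n=\frac{1}{1-(\lambda_1-\lambda_2)z-\lambda_1\lambda_2z^2}$. *)

theory Defs
  imports Complex_Main "HOL-Computational_Algebra.Computational_Algebra"
begin

fun mersenne_lucas :: "nat \<Rightarrow> complex poly" where
  "mersenne_lucas 0 = [:2:]"
| "mersenne_lucas (Suc 0) = [:0, 3:]"
| "mersenne_lucas (Suc (Suc n)) =
     [:0, 3:] * mersenne_lucas (Suc n) - [:2:] * mersenne_lucas n"

fun gauss_mersenne_lucas :: "nat \<Rightarrow> complex poly" where
  "gauss_mersenne_lucas 0 = [:2, 3 * \<i> / 2:]"
| "gauss_mersenne_lucas (Suc 0) = [:2 * \<i>, 3:]"
| "gauss_mersenne_lucas (Suc (Suc n)) =
     [:0, 3:] * gauss_mersenne_lucas (Suc n) - [:2:] * gauss_mersenne_lucas n"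

text \<open>
  \<open>sym_S n a b\<close> is $S_n(a+b)$. The alphabet $\{a, b\}$ is passed as two separate
  arguments because $a+b$ is not a sum of numbers here; accordingly
  $S_n(a + [-b])$ is \<open>sym_S n a (- b)\<close>.
  The index is an integer, since $S_{-1}$ occurs. The denominator below has constant
  term 1, so the quotient is the usual one of formal power series.
\<close>

definition sym_S :: "int \<Rightarrow> complex \<Rightarrow> complex \<Rightarrow> complex" where
  "sym_S n a b =
     (if n < 0 then 0
      else fps_nth (1 / ((1 - fps_const a * fps_X) * (1 - fps_const b * fps_X))) (nat n))"

end

theory Submission
  imports Defs
begin

text \<open>
  With \<open>a = \<lambda>\<^sub>1\<close> and \<open>b = - \<lambda>\<^sub>2\<close> one has \<open>a + b = 3 x\<close> and \<open>a b = 2\<close>, so \<open>a\<close> and \<open>b\<close> are the roots of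
  the characteristic polynomial \<open>t\<^sup>2 - 3 x t + 2\<close> shared by both polynomial families. The
  functions \<open>S\<^sub>n(a + b)\<close> satisfy the same recurrence, and \<open>S\<^sub>n\<close> and \<open>S\<^sub>n\<^sub>-\<^sub>1\<close> start with \<open>1, a + b\<close>
  and \<open>0, 1\<close>. Hence every solution \<open>u\<close> of the recurrence is the combination
  \<open>u\<^sub>0 S\<^sub>n + (u\<^sub>1 - (a + b) u\<^sub>0) S\<^sub>n\<^sub>-\<^sub>1\<close> (\<open>recurrence_solution_sym_S\<close>), and the two
  identities result from inserting the initial values. Working with the recurrence instead of
  the quotient \<open>(a\<^sup>n\<^sup>+\<^sup>1 - b\<^sup>n\<^sup>+\<^sup>1) / (a - b)\<close> covers the double root \<open>a = b\<close>, that is \<open>s = 0\<close>,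
  by the same argument.
\<close>

lemma sym_S_neg: "k < 0 \<Longrightarrow> sym_S k a b = 0"
  by (simp add: sym_S_def)

text \<open>
  Clearing the denominator and expanding it. In this division-free form, comparing coefficients
  yields \<open>S\<^sub>1\<close> and the recurrence for \<open>S\<^sub>n\<close>.
\<close>

lemma sym_S_generating_function:
  fixes a b :: complex
  defines "F \<equiv> 1 / ((1 - fps_const a * fps_X) * (1 - fps_const b * fps_X))"
  shows "F = 1 + fps_X * (fps_const (a + b) * F - fps_const (a * b) * (fps_X * F))"
proof -
  define D where "D = (1 - fps_const a * fps_X) * (1 - fps_const b * fps_X)"
  have "fps_nth D 0 \<noteq> 0"
    by (simp add: D_def)
  then have "F * D = 1"
    by (simp add: F_def D_def[symmetric] fps_divide_unit inverse_mult_eq_1)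
  moreover have "D = 1 - fps_X * (fps_const (a + b) - fps_const (a * b) * fps_X)"
    by (simp add: D_def algebra_simps flip: fps_const_add fps_const_mult)
  ultimately show ?thesis
    by (simp add: algebra_simps)
qed

lemma sym_S_0: "sym_S 0 a b = 1"
  by (simp add: sym_S_def)

lemma sym_S_1: "sym_S 1 a b = a + b"
  unfolding sym_S_def by (subst sym_S_generating_function) simp

lemma sym_S_recurrence:
  "sym_S (int n + 2) a b = (a + b) * sym_S (int n + 1) a b - a * b * sym_S (int n) a b"
proof -
  define F where "F = 1 / ((1 - fps_const a * fps_X) * (1 - fps_const b * fps_X))"
  have "F = 1 + fps_X * (fps_const (a + b) * F - fps_const (a * b) * (fps_X * F))"
    unfolding F_def by (rule sym_S_generating_function)
  then have "fps_nth F (Suc (Suc n))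
      = fps_nth (1 + fps_X * (fps_const (a + b) * F - fps_const (a * b) * (fps_X * F)))
          (Suc (Suc n))"
    by simp
  also have "\<dots> = (a + b) * fps_nth F (Suc n) - a * b * fps_nth F n"
    by (simp del: fps_const_add fps_const_mult)
  finally show ?thesis
    by (simp add: sym_S_def F_def nat_add_distrib)
qed

text \<open>
  The right-hand side solves the recurrence and has the initial values \<open>u 0\<close> and \<open>u 1\<close>. The
  convention \<open>S\<^sub>-\<^sub>1 = 0\<close> is what makes the formula correct at \<open>n = 0\<close>.
\<close>

lemma recurrence_solution_sym_S:
  fixes u :: "nat \<Rightarrow> complex"
  assumes rec: "\<And>n. u (Suc (Suc n)) = (a + b) * u (Suc n) - a * b * u n"
  shows "u n = u 0 * sym_S (int n) a b + (u 1 - (a + b) * u 0) * sym_S (int n - 1) a b"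
proof (induction n rule: induct_nat_012)
  case 0
  show ?case
    by (simp add: sym_S_0 sym_S_neg)
next
  case 1
  show ?case
    by (simp add: sym_S_0 sym_S_1 algebra_simps)
next
  case (ge2 n)
  have S: "sym_S (int (Suc (Suc n))) a b
      = (a + b) * sym_S (int (Suc n)) a b - a * b * sym_S (int n) a b"
    using sym_S_recurrence[of n a b] by (simp add: add.commute)
  \<comment> \<open>The shifted sequence obeys the recurrence down to index \<open>1\<close>, again because \<open>S\<^sub>-\<^sub>1 = 0\<close>.\<close>
  have T: "sym_S (int (Suc (Suc n)) - 1) a b
      = (a + b) * sym_S (int (Suc n) - 1) a b - a * b * sym_S (int n - 1) a b"
  proof (cases n)
    case 0
    then show ?thesis
      by (simp add: sym_S_0 sym_S_1 sym_S_neg)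
  next
    case (Suc m)
    then show ?thesis
      using sym_S_recurrence[of m a b] by (simp add: add.commute)
  qed
  show ?case
    unfolding rec[of n] ge2.IH S T by algebra
qed

theorem theorem10:
  fixes x s l1 l2 :: complex and n :: nat
  assumes "s\<^sup>2 = 9 * x\<^sup>2 - 8"
    and "l1 = (3 * x + s) / 2"
    and "l2 = - ((3 * x - s) / 2)"
  shows "poly (mersenne_lucas n) x =
           2 * sym_S (int n) l1 (- l2) - 3 * x * sym_S (int n - 1) l1 (- l2)
       \<and> poly (gauss_mersenne_lucas n) x =
           (2 + 3 * \<i> * x / 2) * sym_S (int n) l1 (- l2)
           + (\<i> * (2 - 9 / 2 * x\<^sup>2) - 3 * x) * sym_S (int n - 1) l1 (- l2)"
proof -
  have "l1 + - l2 = 3 * x"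
    by (simp add: assms(2,3) field_simps)
  \<comment> \<open>The sum of the roots is \<open>3 x\<close> for any \<open>s\<close>; the product is where the equation for \<open>s\<^sup>2\<close> enters.\<close>
  moreover have "l1 * - l2 = 2"
  proof -
    have "l1 * - l2 = (9 * x\<^sup>2 - s\<^sup>2) / 4"
      by (simp add: assms(2,3) power2_eq_square algebra_simps)
    then show ?thesis
      by (simp add: assms(1))
  qed
  ultimately have solution: "u n = u 0 * sym_S (int n) l1 (- l2)
      + (u 1 - 3 * x * u 0) * sym_S (int n - 1) l1 (- l2)"
    if "\<And>k. u (Suc (Suc k)) = 3 * x * u (Suc k) - 2 * u k" for u :: "nat \<Rightarrow> complex"
    using recurrence_solution_sym_S[of u l1 "- l2" n] that by metis
  have "poly (mersenne_lucas n) x =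
      2 * sym_S (int n) l1 (- l2) + (3 * x - 3 * x * 2) * sym_S (int n - 1) l1 (- l2)"
    using solution[of "\<lambda>k. poly (mersenne_lucas k) x"] by (simp add: mult.commute)
  moreover have "poly (gauss_mersenne_lucas n) x =
      (2 + 3 * \<i> * x / 2) * sym_S (int n) l1 (- l2)
      + (2 * \<i> + 3 * x - 3 * x * (2 + 3 * \<i> * x / 2)) * sym_S (int n - 1) l1 (- l2)"
    using solution[of "\<lambda>k. poly (gauss_mersenne_lucas k) x"] by (simp add: mult.commute mult.left_commute)
  moreover have "2 * \<i> + 3 * x - 3 * x * (2 + 3 * \<i> * x / 2) = \<i> * (2 - 9 / 2 * x\<^sup>2) - 3 * x"
    by (simp add: power2_eq_square algebra_simps)
  ultimately show ?thesis
    by simp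
qed

end
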